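(* Let $M$ be a positive integer, let $\mathsf{snr}>0$, and let $\mathbf{h}\in\mathbb{C}^M$ be a random vector with independent $\mathcal{CN}(0,1)$ entries. Let $\gamma = \frac{\mathsf{snr}}{M}\|\mathbf{h}\|^2$ be the equivalent SNR of a MISO system with $M$ transmit antennas employing orthogonal space-time block coding (OSTBC), and let $g(\gamma)=1+\gamma$. Then for every $s\in\mathbb{R}$ the Mellin transform $\mathcal{M}^{\mathrm{OSTBC}}_{g(\gamma)}(s)=\mathbb{E}[(1+\gamma)^{s-1}]$ of the service process is $$\mathcal{M}^{\mathrm{OSTBC}}_{g(\gamma)}(s) = \left(\frac{\mathsf{snr}}{M}\right)^{-M} U\!\left(M, M+s, \frac{M}{\mathsf{snr}}\right).$$
   Context: $\mathcal{CN}(0,1)$ is the circularly-symmetric complex Gaussian distribution with unit variance. The Mellin transform of a nonnegative random variable $X$ is $\mathcal{M}_X(s)=\mathbb{E}[X^{s-1}]$, considered for real $s$. $U(a,b,z)$ is Tricomi's confluent hypergeometric function (of the second kind), given for $a>0$, $z>0$, $b\in\mathbb{R}$ by $U(a,b,z) = \frac{1}{\Gamma(a)}\int_0^\infty e^{-zt}t^{a-1}(1+t)^{b-a-1}\,\mathrm{d}t$. *)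

theory Defs
  imports "HOL-Probability.Probability"
begin

text \<open>
  The circularly-symmetric complex Gaussian law of mean 0 and variance \<open>v\<close> (that is,
  \<open>E |Z|^2 = v\<close>): the real and imaginary parts are independent, each of variance \<open>v / 2\<close>.
  The second argument of \<^const>\<open>normal_density\<close> is the standard deviation.
\<close>

definition complex_normal_distributed :: "'a measure \<Rightarrow> ('a \<Rightarrow> complex) \<Rightarrow> real \<Rightarrow> bool" where
  "complex_normal_distributed P Z v \<longleftrightarrow>
     prob_space.indep_var P borel (\<lambda>\<omega>. Re (Z \<omega>)) borel (\<lambda>\<omega>. Im (Z \<omega>)) \<and>
     distributed P lborel (\<lambda>\<omega>. Re (Z \<omega>)) (\<lambda>x. ennreal (normal_density 0 (sqrt (v / 2)) x)) \<and>
     distributed P lborel (\<lambda>\<omega>. Im (Z \<omega>)) (\<lambda>x. ennreal (normal_density 0 (sqrt (v / 2)) x))"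

text \<open>
  The moments of a positive random variable at real \<open>s\<close>. The integrand is only meaningful for
  \<open>X > 0\<close>, since \<open>0 powr a = 0\<close> for all \<open>a\<close>; the integral is 0 if the moment is infinite.
\<close>

definition mellin_transform :: "'a measure \<Rightarrow> ('a \<Rightarrow> real) \<Rightarrow> real \<Rightarrow> real" where
  "mellin_transform P X s = (\<integral>\<omega>. X \<omega> powr (s - 1) \<partial>P)"

text \<open>Tricomi's function by its integral representation, for \<open>a > 0\<close> and \<open>z > 0\<close> only.\<close>

definition tricomi_U :: "real \<Rightarrow> real \<Rightarrow> real \<Rightarrow> real" where
  "tricomi_U a b z =
     1 / Gamma a * (LBINT t:{0<..}. exp (- z * t) * t powr (a - 1) * (1 + t) powr (b - a - 1))"

text \<open>
  Equivalent SNR of orthogonal space-time block coding over the channel vector \<open>h\<close>, with one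
  transmit antenna per element of the index type; the norm is the Euclidean one.
\<close>

definition ostbc_snr :: "real \<Rightarrow> complex ^ 'm \<Rightarrow> real" where
  "ostbc_snr snr h = snr / real CARD('m) * (norm h)\<^sup>2"

end

theory Submission
  imports Defs
begin

text \<open>
  The map \<open>z \<mapsto> |z|\<^sup>2\<close> sends Lebesgue measure on the plane to \<open>\<pi>\<close> times Lebesgue measure on the
  half-line, because a disc of squared radius \<open>u\<close> has area \<open>\<pi> u\<close>. A circularly-symmetric Gaussian
  density depends on \<open>|z|\<^sup>2\<close> only, so the squared modulus is exponentially distributed, and the
  sum of \<open>M\<close> independent copies follows an Erlang law. Scaling by \<open>snr / M\<close>, the moment in
  question is the integral of \<open>(1 + t) powr (s - 1)\<close> against the Erlang density, which is the
  integral representation of \<open>U\<close>.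
\<close>

text \<open>For \<open>u \<ge> 0\<close> the set is the closed disc of radius \<open>sqrt u\<close>;
  the \<open>max\<close> covers negative \<open>u\<close>, where the set is empty.\<close>

lemma emeasure_lborel_norm_square_le:
  "emeasure lborel {z :: real \<times> real. (norm z)\<^sup>2 \<le> u} = ennreal (pi * max 0 u)"
proof (cases "u < 0")
  case True
  then have "{z :: real \<times> real. (norm z)\<^sup>2 \<le> u} = {}"
    by (auto simp: not_le intro: less_le_trans)
  with True show ?thesis by (simp only: emeasure_empty) simp
next
  case False
  then have "{z :: real \<times> real. (norm z)\<^sup>2 \<le> u} = cball 0 (sqrt u)"
    by (auto simp: real_le_rsqrt dest: real_sqrt_le_mono)
      (metis norm_ge_zero not_le power_mono real_sqrt_pow2)
  with False show ?thesis
    by (simp add: emeasure_cball unit_ball_vol_2)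
qed

text \<open>Both measures give \<open>{..a}\<close> the mass \<open>pi * max 0 a\<close>, and these
  half-lines are an intersection-stable generator of the Borel sets. The total mass is infinite, so
  uniqueness rests on the exhaustion by \<open>{..real i}\<close>, where both are finite.\<close>

lemma distr_lborel_norm_square:
  "distr lborel lborel (\<lambda>z :: real \<times> real. (norm z)\<^sup>2) =
    density lborel (\<lambda>x. ennreal pi * indicator {0..} x)" (is "?D = ?E")
proof (rule measure_eqI_generator_eq[where E = "range atMost" and A = "\<lambda>i. {..real i}" and \<Omega> = UNIV])
  have D: "emeasure ?D {..a} = ennreal (pi * max 0 a)" for a
    using emeasure_lborel_norm_square_le[of a]
    by (subst emeasure_distr) (auto simp: vimage_def)
  have E: "emeasure ?E {..a} = ennreal (pi * max 0 a)" for a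
  proof -
    have "emeasure ?E {..a} = (\<integral>\<^sup>+x. ennreal pi * indicator {0..a} x \<partial>lborel)"
      by (subst emeasure_density) (auto intro!: nn_integral_cong split: split_indicator)
    also have "\<dots> = ennreal (pi * max 0 a)"
      by (subst nn_integral_cmult) (auto simp: ennreal_mult' max_def emeasure_lborel_Icc_eq)
    finally show ?thesis .
  qed
  show "emeasure ?D X = emeasure ?E X" if "X \<in> range atMost" for X
    using that by (auto simp: D E)
  show "emeasure ?D {..real i} \<noteq> \<infinity>" for i
    by (simp add: D)
  show "Int_stable (range atMost :: real set set)"
    by (auto simp: Int_stable_def)
  show "sets ?D = sigma_sets UNIV (range atMost)" "sets ?E = sigma_sets UNIV (range atMost)"
    by (auto simp: borel_eq_atMost)
  show "(\<Union>i. {..real i}) = UNIV"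
    by (auto intro: real_arch_simple)
qed auto

lemma (in prob_space) exponential_distributed_norm_square:
  assumes Z: "complex_normal_distributed M Z v" and v: "v > 0"
  shows "distributed M lborel (\<lambda>\<omega>. (norm (Z \<omega>))\<^sup>2) (exponential_density (1 / v))"
proof -
  let ?N = "\<lambda>x. ennreal (normal_density 0 (sqrt (v / 2)) x)"
  let ?q = "\<lambda>z :: real \<times> real. (norm z)\<^sup>2"
  let ?XY = "\<lambda>\<omega>. (Re (Z \<omega>), Im (Z \<omega>))"
  \<comment> \<open>The product of two centred normal densities of variance \<open>v / 2\<close>,
    written as a function of the squared modulus alone.\<close>
  define f where "f x = ennreal (exp (- x / v) / (pi * v))" for x
  have f [measurable]: "f \<in> borel_measurable borel"
    unfolding f_def by measurable
  have density_eq: "?N x * ?N y = f (?q (x, y))" for x y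
    using v by (simp add: f_def normal_density_def norm_Pair ennreal_mult'[symmetric]
      exp_add[symmetric] add_divide_distrib diff_divide_distrib)
  have "distributed M (lborel \<Otimes>\<^sub>M lborel) ?XY (\<lambda>(x, y). ?N x * ?N y)"
    using Z unfolding complex_normal_distributed_def
    by (intro distributed_joint_indep) (auto intro: lborel.sigma_finite_measure_axioms
      simp: indep_var_eq)
  then have XY: "distributed M lborel ?XY (\<lambda>z. f (?q z))"
    by (simp add: lborel_prod density_eq case_prod_unfold)
  have XY_measurable: "?XY \<in> borel_measurable M"
    using distributed_measurable[OF XY] by simp
  have "(\<lambda>\<omega>. (norm (Z \<omega>))\<^sup>2) = ?q \<circ> ?XY"
    by (auto simp: norm_Pair cmod_power2)
  moreover have "distr M lborel (?q \<circ> ?XY) = density lborel (exponential_density (1 / v))"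
  proof -
    have "distr M lborel (?q \<circ> ?XY) = distr (distr M lborel ?XY) lborel ?q"
      by (subst distr_distr) (auto simp: XY_measurable)
    also have "\<dots> = distr (density lborel (\<lambda>z. f (?q z))) lborel ?q"
      using distributed_distr_eq_density[OF XY] by simp
    \<comment> \<open>A density that factors through \<open>?q\<close> passes across the
      push-forward along \<open>?q\<close>. The factor \<open>pi\<close> of the push-forward then
      cancels the one in \<open>f\<close>.\<close>
    also have "\<dots> = density (distr lborel lborel ?q) f"
      by (subst density_distr) auto
    also have "\<dots> = density lborel (\<lambda>x. (ennreal pi * indicator {0..} x) * f x)"
      unfolding distr_lborel_norm_square by (subst density_density_eq) auto
    also have "\<dots> = density lborel (exponential_density (1 / v))"
      using v by (intro density_cong) (auto simp: f_def exponential_density_def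
        ennreal_mult'[symmetric] split: split_indicator)
    finally show ?thesis .
  qed
  ultimately show ?thesis
    unfolding distributed_def by (auto intro!: measurable_comp[OF XY_measurable])
qed

lemma (in prob_space) erlang_distributed_norm_square_vec:
  fixes h :: "'a \<Rightarrow> complex ^ 'm"
  assumes indep: "indep_vars (\<lambda>_. borel) (\<lambda>i \<omega>. h \<omega> $ i) UNIV"
    and h: "\<And>i. complex_normal_distributed M (\<lambda>\<omega>. h \<omega> $ i) v" and v: "v > 0"
  shows "distributed M lborel (\<lambda>\<omega>. (norm (h \<omega>))\<^sup>2) (erlang_density (CARD('m) - 1) (1 / v))"
proof -
  have "indep_vars (\<lambda>_. borel) (\<lambda>i \<omega>. (norm (h \<omega> $ i))\<^sup>2) UNIV"
    using indep by (rule indep_vars_compose2) auto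
  \<comment> \<open>An exponential law is the Erlang law of index 0, and index \<open>k\<close>
    stands for \<open>k + 1\<close> summands; hence each term counts \<open>Suc 0\<close> and 1 is
    subtracted at the end.\<close>
  then have "distributed M lborel (\<lambda>\<omega>. \<Sum>i\<in>UNIV. (norm (h \<omega> $ i))\<^sup>2)
      (erlang_density ((\<Sum>i\<in>(UNIV :: 'm set). Suc 0) - 1) (1 / v))"
    using exponential_distributed_norm_square[OF h v] v
    by (intro erlang_distributed_sum) auto
  then show ?thesis
    by (simp add: norm_vec_def L2_set_def sum_nonneg)
qed

text \<open>A Bochner integral defaults to 0 when the integrand is not integrable; this result makes
  the Mellin transform a genuine moment. The bound is a natural power of \<open>Y + 1\<close>, which
  expands binomially into finite Erlang moments.\<close>

lemma (in prob_space) erlang_distributed_integrable_powr: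
  assumes Y: "distributed M lborel Y (erlang_density k l)" and l: "0 < l"
    and nonneg: "\<And>\<omega>. 0 \<le> Y \<omega>"
  shows "integrable M (\<lambda>\<omega>. (1 + Y \<omega>) powr p)"
proof (rule Bochner_Integration.integrable_bound)
  \<comment> \<open>For negative \<open>p\<close> this is 0, and the bound 1 still holds because the
    base is at least 1.\<close>
  let ?n = "nat \<lceil>p\<rceil>"
  show "integrable M (\<lambda>\<omega>. (Y \<omega> + 1) ^ ?n)"
    unfolding binomial_ring using erlang_ith_moment_integrable[OF l Y] by auto
  have [measurable]: "Y \<in> borel_measurable M"
    using distributed_measurable[OF Y] by simp
  show "(\<lambda>\<omega>. (1 + Y \<omega>) powr p) \<in> borel_measurable M"
    by measurable
  have "(1 + Y \<omega>) powr p \<le> (Y \<omega> + 1) ^ ?n" for \<omega>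
  proof -
    have "(1 + Y \<omega>) powr p \<le> (1 + Y \<omega>) powr real ?n"
      using nonneg[of \<omega>] by (intro powr_mono) linarith+
    also have "\<dots> = (Y \<omega> + 1) ^ ?n"
      using nonneg[of \<omega>] by (simp add: powr_realpow add.commute)
    finally show ?thesis .
  qed
  then show "AE \<omega> in M. norm ((1 + Y \<omega>) powr p) \<le> norm ((Y \<omega> + 1) ^ ?n)"
    using nonneg by (auto simp: add_nonneg_nonneg)
qed

lemma (in prob_space) mellin_transform_one_plus_erlang:
  assumes Y: "distributed M lborel Y (erlang_density k l)" and l: "0 < l"
  shows "mellin_transform M (\<lambda>\<omega>. 1 + Y \<omega>) s =
    l ^ Suc k * tricomi_U (real (Suc k)) (real (Suc k) + s) l"
proof -
  have "mellin_transform M (\<lambda>\<omega>. 1 + Y \<omega>) s =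
      (\<integral>t. erlang_density k l t * (1 + t) powr (s - 1) \<partial>lborel)"
    unfolding mellin_transform_def using l
    by (subst distributed_integral[OF Y, symmetric]) auto
  also have "\<dots> = (\<integral>t. l ^ Suc k / fact k * (indicator {0<..} t *\<^sub>R
      (exp (- l * t) * t powr (real (Suc k) - 1) * (1 + t) powr (real (Suc k) + s - real (Suc k) - 1)))
      \<partial>lborel)"
  \<comment> \<open>The exponent of \<open>1 + t\<close> collapses to \<open>s - 1\<close>. The
    Erlang density lives on \<open>t \<ge> 0\<close> but the integral for \<open>U\<close> on
    \<open>t > 0\<close>; for \<open>k = 0\<close> the integrands differ at \<open>t = 0\<close>, so
    they agree only almost everywhere.\<close>
  proof (rule integral_cong_AE)
    show "AE t in lborel. erlang_density k l t * (1 + t) powr (s - 1) =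
      l ^ Suc k / fact k * (indicator {0<..} t *\<^sub>R
      (exp (- l * t) * t powr (real (Suc k) - 1) * (1 + t) powr (real (Suc k) + s - real (Suc k) - 1)))"
      using AE_lborel_singleton[of "0 :: real"]
      by eventually_elim (auto simp: erlang_density_def powr_realpow)
  qed measurable
  also have "\<dots> = l ^ Suc k * tricomi_U (real (Suc k)) (real (Suc k) + s) l"
    unfolding tricomi_U_def set_lebesgue_integral_def Gamma_fact[symmetric]
    by (simp add: add.commute)
  finally show ?thesis .
qed

theorem corollary1:
  fixes P :: "'a measure"
    and h :: "'a \<Rightarrow> complex ^ 'm"
    and snr s :: real
    and M :: nat
  assumes "prob_space P"
    and "M = CARD('m)"
    and "snr > 0"
    and "prob_space.indep_vars P (\<lambda>_. borel) (\<lambda>i \<omega>. h \<omega> $ i) UNIV"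
    and "\<And>i. complex_normal_distributed P (\<lambda>\<omega>. h \<omega> $ i) 1"
  shows "integrable P (\<lambda>\<omega>. (1 + ostbc_snr snr (h \<omega>)) powr (s - 1)) \<and>
    mellin_transform P (\<lambda>\<omega>. 1 + ostbc_snr snr (h \<omega>)) s =
      (snr / real M) powi (- int M) * tricomi_U (real M) (real M + s) (real M / snr)"
proof -
  interpret prob_space P by fact
  have M: "M > 0" "Suc (M - 1) = M"
    using assms(2) by auto
  \<comment> \<open>Multiplying by \<open>snr / real M\<close> divides the rate 1 of the
    unit-variance case by that factor.\<close>
  have Y: "distributed P lborel (\<lambda>\<omega>. ostbc_snr snr (h \<omega>)) (erlang_density (M - 1) (real M / snr))"
    using erlang_distributed_mult_const[OF erlang_distributed_norm_square_vec[OF assms(4,5)],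
        of "snr / real M"] M assms(2,3)
    by (simp add: ostbc_snr_def)
  have l: "0 < real M / snr"
    using M assms(3) by simp
  have "0 \<le> ostbc_snr snr (h \<omega>)" for \<omega>
    using assms(3) by (simp add: ostbc_snr_def)
  then have "integrable P (\<lambda>\<omega>. (1 + ostbc_snr snr (h \<omega>)) powr (s - 1))"
    by (rule erlang_distributed_integrable_powr[OF Y l])
  moreover have "(real M / snr) ^ M = (snr / real M) powi (- int M)"
    by (simp add: power_int_minus power_inverse[symmetric])
  ultimately show ?thesis
    using mellin_transform_one_plus_erlang[OF Y l, of s] by (simp only: M)
qed

end
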